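(* $\mathrm{Cl}_q(n,1/2)\cong\mathrm{Cl}(\mathbb{k}^n\oplus(\mathbb{k}^n)^* )$ as $\mathbb{k}$-algebras, where the right side is the classical Clifford algebra generated by $v_1,\dots,v_n,v_1^*,\dots,v_n^*$ subject to $v_av_b+v_bv_a=v_a^*v_b^*+v_b^*v_a^*=0$ and $v_av_b^*+v_b^*v_a=\delta_{ab}$.
   Context: Let $\mathbb{k}$ be a field of characteristic different from $2$, $q\in\mathbb{k}^\times$, $n$ a positive integer. $\mathrm{Cl}_q(n,1/2)$ is the unital associative $\mathbb{k}$-algebra generated by $\omega_a,\phi_a,\phi_a^*$ ($a=1,\dots,n$) subject to, for all $a,b$: $\omega_a\omega_b=\omega_b\omega_a$; $\omega_a^{2}=(1+q^{-1})\omega_a-q^{-1}$; $\omega_a\phi_b=q^{\delta_{ab}}\phi_b\omega_a$; $\omega_a\phi_b^*=q^{-\delta_{ab}}\phi_b^*\omega_a$; $\phi_a\phi_b+\phi_b\phi_a=0$; $\phi_a^*\phi_b^*+\phi_b^*\phi_a^*=0$; $\phi_a\phi_a^*+\phi_a^*\phi_a=1$; $\phi_a\phi_a^*+q^{-1}\phi_a^*\phi_a=\omega_a$; $\phi_a\phi_b^*+\phi_b^*\phi_a=0$ if $a\neq b$ (this is the case $k=1/2$ of the half-twist quantum Clifford algebra, whose relations are those with $\omega_a^{4k}=(1+q^{-2k})\omega_a^{2k}-q^{-2k}$ and $\phi_a\phi_a^*+q^{-2k}\phi_a^*\phi_a=\omega_a^{2k}$). *)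

theory Defs
  imports "HOL-Algebra.QuotRing"
begin

text \<open>Noncommutative polynomials: finitely supported functions from words (lists of
generators) to the field, supported on words over the generator set X.\<close>

definition fa_carrier :: "'x set \<Rightarrow> ('x list \<Rightarrow> 'a::field) set" where
  "fa_carrier X = {f. finite {w. f w \<noteq> 0} \<and> (\<forall>w. f w \<noteq> 0 \<longrightarrow> set w \<subseteq> X)}"

definition fa_mult :: "('x list \<Rightarrow> 'a::field) \<Rightarrow> ('x list \<Rightarrow> 'a) \<Rightarrow> ('x list \<Rightarrow> 'a)" where
  "fa_mult f g = (\<lambda>w. \<Sum>i\<le>length w. f (take i w) * g (drop i w))"

definition fa_add :: "('x list \<Rightarrow> 'a::field) \<Rightarrow> ('x list \<Rightarrow> 'a) \<Rightarrow> ('x list \<Rightarrow> 'a)" where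
  "fa_add f g = (\<lambda>w. f w + g w)"

definition fa_smult :: "'a::field \<Rightarrow> ('x list \<Rightarrow> 'a) \<Rightarrow> ('x list \<Rightarrow> 'a)" where
  "fa_smult c f = (\<lambda>w. c * f w)"

definition fa_scal :: "'a::field \<Rightarrow> ('x list \<Rightarrow> 'a)" where
  "fa_scal c = (\<lambda>w. if w = [] then c else 0)"

definition fa_gen :: "'x \<Rightarrow> ('x list \<Rightarrow> 'a::field)" where
  "fa_gen x = (\<lambda>w. if w = [x] then 1 else 0)"

definition free_alg :: "'x set \<Rightarrow> ('x list \<Rightarrow> 'a::field) ring" where
  "free_alg X = \<lparr>carrier = fa_carrier X, mult = fa_mult, one = fa_scal 1,
                 zero = (\<lambda>w. 0), add = fa_add\<rparr>"

definition presented_alg :: "'x set \<Rightarrow> ('x list \<Rightarrow> 'a::field) set \<Rightarrow> ('x list \<Rightarrow> 'a) set ring" where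
  "presented_alg X Rel = free_alg X Quot genideal (free_alg X) Rel"

definition pa_scal :: "'x set \<Rightarrow> ('x list \<Rightarrow> 'a::field) set \<Rightarrow> 'a \<Rightarrow> ('x list \<Rightarrow> 'a) set" where
  "pa_scal X Rel c = genideal (free_alg X) Rel +>\<^bsub>free_alg X\<^esub> fa_scal c"

text \<open>Isomorphism of k-algebras: a ring isomorphism compatible with the structure maps
from k (equivalently, a k-linear ring isomorphism).\<close>
definition alg_isomorphic ::
  "'x set \<Rightarrow> ('x list \<Rightarrow> 'a::field) set \<Rightarrow> 'y set \<Rightarrow> ('y list \<Rightarrow> 'a) set \<Rightarrow> bool" where
  "alg_isomorphic X R Y S =
     (\<exists>\<phi>. \<phi> \<in> ring_iso (presented_alg X R) (presented_alg Y S) \<and>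
          (\<forall>c. \<phi> (pa_scal X R c) = pa_scal Y S c))"

datatype qgen = Om nat | Ph nat | PhS nat

definition qgens :: "nat \<Rightarrow> qgen set" where
  "qgens n = (\<Union>a\<in>{1..n}. {Om a, Ph a, PhS a})"

abbreviation (input) fm (infixl \<open>**\<close> 70) where "fm \<equiv> fa_mult"
abbreviation (input) fp (infixl \<open>++\<close> 65) where "fp \<equiv> fa_add"

definition delta :: "nat \<Rightarrow> nat \<Rightarrow> nat" where
  "delta a b = (if a = b then 1 else 0)"

definition clq_rels :: "'a::field \<Rightarrow> nat \<Rightarrow> (qgen list \<Rightarrow> 'a) set" where
  "clq_rels q n = (\<Union>a\<in>{1..n}. \<Union>b\<in>{1..n}.
     { fa_gen (Om a) ** fa_gen (Om b) ++ fa_smult (-1) (fa_gen (Om b) ** fa_gen (Om a)),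
       fa_gen (Om a) ** fa_gen (Om a) ++ fa_smult (-(1 + inverse q)) (fa_gen (Om a))
         ++ fa_scal (inverse q),
       fa_gen (Om a) ** fa_gen (Ph b) ++ fa_smult (- (q ^ delta a b)) (fa_gen (Ph b) ** fa_gen (Om a)),
       fa_gen (Om a) ** fa_gen (PhS b)
         ++ fa_smult (- (inverse q ^ delta a b)) (fa_gen (PhS b) ** fa_gen (Om a)),
       fa_gen (Ph a) ** fa_gen (Ph b) ++ fa_gen (Ph b) ** fa_gen (Ph a),
       fa_gen (PhS a) ** fa_gen (PhS b) ++ fa_gen (PhS b) ** fa_gen (PhS a),
       fa_gen (Ph a) ** fa_gen (PhS a) ++ fa_gen (PhS a) ** fa_gen (Ph a) ++ fa_scal (-1),
       fa_gen (Ph a) ** fa_gen (PhS a) ++ fa_smult (inverse q) (fa_gen (PhS a) ** fa_gen (Ph a))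
         ++ fa_smult (-1) (fa_gen (Om a))}
     \<union> (if a \<noteq> b then {fa_gen (Ph a) ** fa_gen (PhS b) ++ fa_gen (PhS b) ** fa_gen (Ph a)} else {}))"

datatype cgen = V nat | VS nat

definition cgens :: "nat \<Rightarrow> cgen set" where
  "cgens n = (\<Union>a\<in>{1..n}. {V a, VS a})"

definition cl_rels :: "nat \<Rightarrow> (cgen list \<Rightarrow> 'a::field) set" where
  "cl_rels n = (\<Union>a\<in>{1..n}. \<Union>b\<in>{1..n}.
     { fa_gen (V a) ** fa_gen (V b) ++ fa_gen (V b) ** fa_gen (V a),
       fa_gen (VS a) ** fa_gen (VS b) ++ fa_gen (VS b) ** fa_gen (VS a),
       fa_gen (V a) ** fa_gen (VS b) ++ fa_gen (VS b) ** fa_gen (V a)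
         ++ fa_scal (- of_nat (delta a b))})"

end

theory Submission
  imports Defs
begin

text \<open>
  The relation \<open>\<phi>\<^sub>a \<phi>\<^sub>a\<^sup>* + q\<^sup>-\<^sup>1 \<phi>\<^sub>a\<^sup>* \<phi>\<^sub>a = \<omega>\<^sub>a\<close> makes the generators \<open>\<omega>\<^sub>a\<close> redundant, so the isomorphism must send
  \<open>\<phi>\<^sub>a, \<phi>\<^sub>a\<^sup>*\<close> to \<open>v\<^sub>a, v\<^sub>a\<^sup>*\<close> and \<open>\<omega>\<^sub>a\<close> to the twist \<open>v\<^sub>a v\<^sub>a\<^sup>* + q\<^sup>-\<^sup>1 v\<^sub>a\<^sup>* v\<^sub>a\<close>. The relations involving \<open>\<omega>\<^sub>a\<close> hold
  for the twist because \<open>v\<^sub>a\<^sup>2 = (v\<^sub>a\<^sup>*)\<^sup>2 = 0\<close> (here characteristic \<open>\<noteq> 2\<close> enters) makes \<open>v\<^sub>a v\<^sub>a\<^sup>*\<close> and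
  \<open>v\<^sub>a\<^sup>* v\<^sub>a\<close> complementary orthogonal idempotents, and because products of two generators with index
  \<open>a\<close> commute with every generator of another index. The homomorphisms in both directions come from
  the universal property of the presentations and are inverse to each other on generators.
\<close>

section \<open>The free algebra as a ring\<close>

lemma fa_mult_Nil [simp]: "fa_mult f g [] = f [] * g []"
  by (simp add: fa_mult_def)

text \<open>The cut before the first letter is split off; every later cut leaves \<open>x\<close> at
  the head of the left factor. The convolution thus becomes a recursion on the word, which is what
  the inductions below use.\<close>

lemma fa_mult_Cons: "fa_mult f g (x # w) = f [] * g (x # w) + fa_mult (\<lambda>u. f (x # u)) g w"
  by (simp add: fa_mult_def sum.atMost_Suc_shift del: sum.atMost_Suc)

lemma fa_mult_add_left: "fa_mult (fa_add f g) h = fa_add (fa_mult f h) (fa_mult g h)"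
  by (simp add: fa_mult_def fa_add_def fun_eq_iff distrib_right sum.distrib)

lemma fa_mult_add_right: "fa_mult f (fa_add g h) = fa_add (fa_mult f g) (fa_mult f h)"
  by (simp add: fa_mult_def fa_add_def fun_eq_iff distrib_left sum.distrib)

lemma fa_mult_smult_left: "fa_mult (fa_smult c f) g = fa_smult c (fa_mult f g)"
  by (simp add: fa_mult_def fa_smult_def fun_eq_iff sum_distrib_left mult.assoc)

lemma fa_mult_assoc: "fa_mult (fa_mult f g) h = fa_mult f (fa_mult g h)"
proof
  fix w
  show "fa_mult (fa_mult f g) h w = fa_mult f (fa_mult g h) w"
  proof (induction w arbitrary: f)
    case (Cons x w)
    \<comment> \<open>Stripping a first letter from a product obeys a Leibniz-like rule: the letter
      comes from \<open>g\<close> if \<open>f\<close> contributes its constant term, and otherwise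
      from \<open>f\<close>. The induction hypothesis is then applied to the stripped
      \<open>f\<close>, so \<open>f\<close> has to be arbitrary.\<close>
    have "(\<lambda>u. fa_mult f g (x # u)) =
        fa_add (fa_smult (f []) (\<lambda>u. g (x # u))) (fa_mult (\<lambda>u. f (x # u)) g)"
      by (simp add: fun_eq_iff fa_mult_Cons fa_add_def fa_smult_def)
    then show ?case
      by (simp add: fa_mult_Cons [of "fa_mult f g"] fa_mult_Cons [of f] fa_mult_Cons [of g]
          fa_mult_add_left fa_mult_smult_left)
        (simp add: fa_add_def fa_smult_def algebra_simps Cons.IH)
  qed (simp add: mult.assoc)
qed

section \<open>Monomials, with scalars and generators as special cases\<close>

definition fa_mono :: "'a::field \<Rightarrow> 'x list \<Rightarrow> 'x list \<Rightarrow> 'a" where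
  "fa_mono c u = (\<lambda>w. if w = u then c else 0)"

lemma fa_scal_eq_mono: "fa_scal c = fa_mono c []"
  by (simp add: fa_scal_def fa_mono_def)

lemma fa_gen_eq_mono: "fa_gen x = fa_mono 1 [x]"
  by (simp add: fa_gen_def fa_mono_def)

lemma fa_mult_scal_left: "fa_mult (fa_scal c) g = fa_smult c g"
proof
  fix w
  show "fa_mult (fa_scal c) g w = fa_smult c g w"
  proof (cases w)
    case (Cons x v)
    then show ?thesis
      by (simp add: fa_mult_Cons) (simp add: fa_mult_def fa_scal_def fa_smult_def)
  qed (simp add: fa_scal_def fa_smult_def)
qed

lemma fa_mult_mono_mono: "fa_mult (fa_mono c u) (fa_mono d v) = fa_mono (c * d) (u @ v)"
proof
  fix w
  show "fa_mult (fa_mono c u) (fa_mono d v) w = fa_mono (c * d) (u @ v) w"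
  proof (induction u arbitrary: w)
    case Nil
    then show ?case
      using fa_mult_scal_left [of c "fa_mono d v"]
      by (simp add: fa_scal_eq_mono fa_smult_def fa_mono_def fun_eq_iff)
  next
    case (Cons x u)
    show ?case
    proof (cases w)
      case Nil
      then show ?thesis by (simp add: fa_mono_def)
    next
      case w: (Cons y w')
      \<comment> \<open>Stripping the letter \<open>y\<close> from the left monomial leaves the
        shorter monomial if the letters agree, and zero otherwise.\<close>
      have "(\<lambda>z. fa_mono c (x # u) (y # z)) = (if y = x then fa_mono c u else (\<lambda>_. 0))"
        by (auto simp: fa_mono_def)
      moreover have "fa_mult (\<lambda>_. 0) (fa_mono d v) w' = 0"
        by (simp add: fa_mult_def)
      moreover have "fa_mono c (x # u) [] = 0"
        by (simp add: fa_mono_def)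
      ultimately show ?thesis
        using Cons.IH [of w'] by (auto simp: w fa_mult_Cons) (auto simp: fa_mono_def)
    qed
  qed
qed

lemma fa_mult_scal_right: "fa_mult f (fa_scal c) = fa_smult c f"
proof
  fix w
  show "fa_mult f (fa_scal c) w = fa_smult c f w"
    by (induction w arbitrary: f) (auto simp: fa_mult_Cons fa_scal_def fa_smult_def)
qed

section \<open>Closure of the carrier, the ring structure, and induction on the support\<close>

lemma fa_mono_in_carrier: "set u \<subseteq> X \<Longrightarrow> fa_mono c u \<in> fa_carrier X"
  by (auto simp: fa_carrier_def fa_mono_def)

lemma fa_scal_in_carrier: "fa_scal c \<in> fa_carrier X"
  by (simp add: fa_scal_eq_mono fa_mono_in_carrier)

lemma fa_gen_in_carrier: "x \<in> X \<Longrightarrow> fa_gen x \<in> fa_carrier X"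
  by (simp add: fa_gen_eq_mono fa_mono_in_carrier)

lemma fa_add_in_carrier:
  assumes "f \<in> fa_carrier X" and "g \<in> fa_carrier X"
  shows "fa_add f g \<in> fa_carrier X"
proof -
  have "{w. fa_add f g w \<noteq> 0} \<subseteq> {w. f w \<noteq> 0} \<union> {w. g w \<noteq> 0}"
    by (auto simp: fa_add_def)
  then show ?thesis
    using assms unfolding fa_carrier_def by (auto intro: finite_subset)
qed

text \<open>A nonzero coefficient of the product needs a nonzero term in the convolution, so its
  word is a concatenation of a word from each support. Finiteness and the restriction to letters of
  \<open>X\<close> both follow.\<close>

lemma fa_mult_in_carrier:
  assumes "f \<in> fa_carrier X" and "g \<in> fa_carrier X"
  shows "fa_mult f g \<in> fa_carrier X"
proof -
  have *: "\<exists>u v. w = u @ v \<and> f u \<noteq> 0 \<and> g v \<noteq> 0" if nz: "fa_mult f g w \<noteq> 0" for w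
  proof -
    obtain i where "f (take i w) * g (drop i w) \<noteq> 0"
      using nz unfolding fa_mult_def by (rule sum.not_neutral_contains_not_neutral)
    then show ?thesis
      by (intro exI [of _ "take i w"] exI [of _ "drop i w"]) auto
  qed
  then have "{w. fa_mult f g w \<noteq> 0} \<subseteq> (\<lambda>(u, v). u @ v) ` ({w. f w \<noteq> 0} \<times> {w. g w \<noteq> 0})"
    by (fastforce simp: image_iff)
  then have "finite {w. fa_mult f g w \<noteq> 0}"
    by (rule finite_subset) (use assms in \<open>simp add: fa_carrier_def\<close>)
  moreover have "set w \<subseteq> X" if "fa_mult f g w \<noteq> 0" for w
    using * [OF that] assms unfolding fa_carrier_def by (elim exE conjE) simp
  ultimately show ?thesis
    by (simp add: fa_carrier_def)
qed

lemma fa_smult_in_carrier: "f \<in> fa_carrier X \<Longrightarrow> fa_smult c f \<in> fa_carrier X"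
  using fa_mult_in_carrier [OF fa_scal_in_carrier] by (metis fa_mult_scal_left)

lemmas fa_in_carrier = fa_scal_in_carrier fa_gen_in_carrier fa_add_in_carrier
  fa_mult_in_carrier fa_smult_in_carrier

lemma free_alg_simps [simp]:
  "carrier (free_alg X) = fa_carrier X"
  "mult (free_alg X) = fa_mult"
  "one (free_alg X) = fa_scal 1"
  "zero (free_alg X) = (\<lambda>w. 0)"
  "add (free_alg X) = fa_add"
  by (simp_all add: free_alg_def)

lemma ring_free_alg: "ring (free_alg X :: ('x list \<Rightarrow> 'a::field) ring)"
proof (rule ringI)
  show "abelian_group (free_alg X :: ('x list \<Rightarrow> 'a) ring)"
  proof (rule abelian_groupI)
    fix f :: "'x list \<Rightarrow> 'a"
    assume "f \<in> carrier (free_alg X)"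
    then show "\<exists>g\<in>carrier (free_alg X). g \<oplus>\<^bsub>free_alg X\<^esub> f = \<zero>\<^bsub>free_alg X\<^esub>"
      using fa_smult_in_carrier [of f X "-1"]
      by (intro bexI [of _ "fa_smult (-1) f"]) (auto simp: fa_add_def fa_smult_def)
  next
    show "\<zero>\<^bsub>free_alg X\<^esub> \<in> carrier (free_alg X :: ('x list \<Rightarrow> 'a) ring)"
      by (simp add: fa_carrier_def)
  qed (simp_all add: fa_add_in_carrier, simp_all add: fa_add_def ac_simps)
  show "Group.monoid (free_alg X :: ('x list \<Rightarrow> 'a) ring)"
    by (rule monoidI)
      (auto simp: fa_in_carrier fa_mult_assoc fa_mult_scal_left fa_mult_scal_right fa_smult_def)
qed (auto simp: fa_mult_add_left fa_mult_add_right)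

text \<open>Induction on the finite support: setting one coefficient to zero splits off a monomial
  and shrinks the support by one word.\<close>

lemma fa_carrier_induct [consumes 1, case_names zero add]:
  assumes "f \<in> fa_carrier X"
    and "P (\<lambda>w. 0)"
    and step: "\<And>f c u. f \<in> fa_carrier X \<Longrightarrow> set u \<subseteq> X \<Longrightarrow> P f \<Longrightarrow> P (fa_add (fa_mono c u) f)"
  shows "P f"
proof -
  define A where "A = {w. f w \<noteq> 0}"
  have "finite A"
    using assms(1) by (simp add: A_def fa_carrier_def)
  then show ?thesis
    using A_def assms(1)
  proof (induction A arbitrary: f rule: finite_induct)
    case empty
    then have "f = (\<lambda>w. 0)" by auto
    then show ?case using assms(2) by simp
  next
    case (insert u A)
    define g where "g = f (u := 0)"
    have supp: "A = {w. g w \<noteq> 0}"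
      using insert.hyps insert.prems(1) by (auto simp: g_def)
    have g: "g \<in> fa_carrier X"
      using insert.hyps(1) insert.prems(2) unfolding fa_carrier_def mem_Collect_eq supp [symmetric]
      by (auto simp: g_def split: if_splits)
    have "f = fa_add (fa_mono (f u) u) g"
      by (auto simp: fa_add_def fa_mono_def g_def)
    moreover have "set u \<subseteq> X"
      using insert.prems by (auto simp: fa_carrier_def)
    ultimately show ?case
      using step [OF g _ insert.IH [OF supp g], of u "f u"] by simp
  qed
qed

section \<open>Algebras over a field and the universal property\<close>

definition pa_class :: "'x set \<Rightarrow> ('x list \<Rightarrow> 'a::field) set \<Rightarrow> ('x list \<Rightarrow> 'a) \<Rightarrow> ('x list \<Rightarrow> 'a) set" where
  "pa_class X Rel f = genideal (free_alg X) Rel +>\<^bsub>free_alg X\<^esub> f"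

lemma pa_scal_eq_class: "pa_scal X Rel c = pa_class X Rel (fa_scal c)"
  by (simp add: pa_scal_def pa_class_def)

context
  fixes X :: "'x set" and Rel :: "('x list \<Rightarrow> 'a::field) set"
  assumes Rel: "Rel \<subseteq> fa_carrier X"
begin

lemma ideal_genideal_free_alg: "ideal (genideal (free_alg X) Rel) (free_alg X)"
  by (rule ring.genideal_ideal [OF ring_free_alg]) (simp add: Rel)

lemma ring_presented_alg: "ring (presented_alg X Rel)"
  unfolding presented_alg_def by (rule ideal.quotient_is_ring [OF ideal_genideal_free_alg])

lemma pa_class_hom: "pa_class X Rel \<in> ring_hom (free_alg X) (presented_alg X Rel)"
  unfolding presented_alg_def pa_class_def [abs_def]
  by (rule ideal.rcos_ring_hom [OF ideal_genideal_free_alg])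

lemma pa_class_closed: "f \<in> fa_carrier X \<Longrightarrow> pa_class X Rel f \<in> carrier (presented_alg X Rel)"
  using ring_hom_closed [OF pa_class_hom, of f] by simp

lemma pa_class_surj:
  assumes "r \<in> carrier (presented_alg X Rel)"
  obtains f where "f \<in> fa_carrier X" and "r = pa_class X Rel f"
  using assms by (auto simp: presented_alg_def pa_class_def FactRing_def A_RCOSETS_def' a_r_coset_def')

lemma pa_class_add:
  "f \<in> fa_carrier X \<Longrightarrow> h \<in> fa_carrier X \<Longrightarrow>
    pa_class X Rel (fa_add f h) = pa_class X Rel f \<oplus>\<^bsub>presented_alg X Rel\<^esub> pa_class X Rel h"
  using ring_hom_add [OF pa_class_hom, of f h] by simp

lemma pa_class_mult:
  "f \<in> fa_carrier X \<Longrightarrow> h \<in> fa_carrier X \<Longrightarrow>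
    pa_class X Rel (fa_mult f h) = pa_class X Rel f \<otimes>\<^bsub>presented_alg X Rel\<^esub> pa_class X Rel h"
  using ring_hom_mult [OF pa_class_hom, of f h] by simp

lemma pa_class_smult:
  "f \<in> fa_carrier X \<Longrightarrow>
    pa_class X Rel (fa_smult c f) = pa_scal X Rel c \<otimes>\<^bsub>presented_alg X Rel\<^esub> pa_class X Rel f"
  using pa_class_mult [of "fa_scal c" f]
  by (simp add: fa_scal_in_carrier fa_mult_scal_left pa_scal_eq_class)

lemma pa_class_one: "pa_class X Rel (fa_scal 1) = \<one>\<^bsub>presented_alg X Rel\<^esub>"
  using ring_hom_one [OF pa_class_hom] by simp

text \<open>A relator lies in the ideal, so its coset is the ideal itself, which is the zero of the
  quotient.\<close>

lemma pa_class_rel: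
  assumes "r \<in> Rel"
  shows "pa_class X Rel r = \<zero>\<^bsub>presented_alg X Rel\<^esub>"
proof -
  interpret F: ring "free_alg X :: ('x list \<Rightarrow> 'a) ring" by (rule ring_free_alg)
  interpret I: ideal "genideal (free_alg X) Rel" "free_alg X :: ('x list \<Rightarrow> 'a) ring"
    by (rule ideal_genideal_free_alg)
  have "r \<in> genideal (free_alg X) Rel"
    using subsetD [OF F.genideal_self assms] Rel by simp
  then show ?thesis
    unfolding presented_alg_def pa_class_def FactRing_def by (simp add: I.a_rcos_const)
qed

end

text \<open>Sums and products of scalars and generators exhaust the free algebra: monomials are
  handled first, then their finite sums.\<close>

lemma fa_hom_unique:
  assumes F: "F \<in> ring_hom (free_alg X) S" and G: "G \<in> ring_hom (free_alg X) S"
    and scal: "\<And>c. F (fa_scal c) = G (fa_scal c)"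
    and gen: "\<And>x. x \<in> X \<Longrightarrow> F (fa_gen x) = G (fa_gen x)"
    and "f \<in> fa_carrier X"
  shows "F f = G f"
proof -
  have mono: "F (fa_mono c u) = G (fa_mono c u)" if "set u \<subseteq> X" for c u
    using that
  \<comment> \<open>Letters are removed from the right, so the coefficient stays with the prefix and
    the base case is the scalar \<open>c\<close>.\<close>
  proof (induction u rule: rev_induct)
    case Nil
    then show ?case using scal by (simp add: fa_scal_eq_mono)
  next
    case (snoc x u)
    have "fa_mono c (u @ [x]) = fa_mult (fa_mono c u) (fa_gen x)"
      by (simp add: fa_gen_eq_mono fa_mult_mono_mono)
    then show ?case
      using snoc ring_hom_mult [OF F, of "fa_mono c u" "fa_gen x"]
        ring_hom_mult [OF G, of "fa_mono c u" "fa_gen x"]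
      by (simp add: fa_mono_in_carrier fa_gen_in_carrier gen)
  qed
  show ?thesis
    using \<open>f \<in> fa_carrier X\<close>
  proof (induction rule: fa_carrier_induct)
    case zero
    have "(\<lambda>w. 0) = fa_scal 0" by (auto simp: fa_scal_def)
    then show ?case using scal by metis
  next
    case (add f c u)
    then show ?case
      using ring_hom_add [OF F, of "fa_mono c u" f] ring_hom_add [OF G, of "fa_mono c u" f]
      by (simp add: fa_mono_in_carrier mono)
  qed
qed

text \<open>An algebra is encoded by its structure map with central image, because
  \<open>alg_isomorphic\<close> compares structure maps and no module structure.\<close>

locale k_algebra = ring R for R (structure) +
  fixes \<kappa> :: "'k::field \<Rightarrow> 'a"
  assumes \<kappa>_closed [simp]: "\<kappa> c \<in> carrier R"
    and \<kappa>_one [simp]: "\<kappa> 1 = \<one>"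
    and \<kappa>_add: "\<kappa> (c + d) = \<kappa> c \<oplus> \<kappa> d"
    and \<kappa>_mult: "\<kappa> (c * d) = \<kappa> c \<otimes> \<kappa> d"
    and \<kappa>_central: "r \<in> carrier R \<Longrightarrow> r \<otimes> \<kappa> c = \<kappa> c \<otimes> r"
begin

lemma \<kappa>_zero [simp]: "\<kappa> 0 = \<zero>"
  using \<kappa>_add [of 0 0] by (metis \<kappa>_closed add.l_cancel_one' add_0)

lemma \<kappa>_uminus: "\<kappa> (- c) = \<ominus> \<kappa> c"
  using \<kappa>_add [of "-c" c] by (metis \<kappa>_closed \<kappa>_zero ab_left_minus minus_equality)

lemma \<kappa>_left_commute:
  "r \<in> carrier R \<Longrightarrow> s \<in> carrier R \<Longrightarrow> r \<otimes> (\<kappa> c \<otimes> s) = \<kappa> c \<otimes> (r \<otimes> s)"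
  by (metis \<kappa>_central \<kappa>_closed m_assoc)

definition word_eval :: "('x \<Rightarrow> 'a) \<Rightarrow> 'x list \<Rightarrow> 'a" where
  "word_eval g w = foldr (\<lambda>x r. g x \<otimes> r) w \<one>"

text \<open>Junk value: outside \<^const>\<open>fa_carrier\<close> the support may be infinite, where the sum is \<open>\<zero>\<close>.\<close>

definition fa_eval :: "('x \<Rightarrow> 'a) \<Rightarrow> ('x list \<Rightarrow> 'k) \<Rightarrow> 'a" where
  "fa_eval g f = (\<Oplus>w\<in>{w. f w \<noteq> 0}. \<kappa> (f w) \<otimes> word_eval g w)"

lemma fa_eval_scal [simp]: "fa_eval g (fa_scal c) = \<kappa> c"
\<comment> \<open>For \<open>c = 0\<close> the support is empty instead of \<open>{[]}\<close>, and
  the empty sum is \<open>\<kappa> 0\<close>.\<close>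
proof (cases "c = 0")
  case False
  then have "{w. fa_scal c w \<noteq> 0} = {[]}"
    by (auto simp: fa_scal_def)
  then have "fa_eval g (fa_scal c) = (\<Oplus>w\<in>{[]}. \<kappa> (fa_scal c w) \<otimes> word_eval g w)"
    unfolding fa_eval_def by (rule arg_cong)
  then show ?thesis
    by (simp add: word_eval_def fa_scal_def)
qed (simp add: fa_eval_def fa_scal_def)

context
  fixes g :: "'x \<Rightarrow> 'a" and X :: "'x set"
  assumes g: "\<And>x. x \<in> X \<Longrightarrow> g x \<in> carrier R"
begin

lemma word_eval_closed: "set w \<subseteq> X \<Longrightarrow> word_eval g w \<in> carrier R"
  by (induction w) (auto simp: word_eval_def g)

lemma word_eval_append:
  "set u \<subseteq> X \<Longrightarrow> set v \<subseteq> X \<Longrightarrow> word_eval g (u @ v) = word_eval g u \<otimes> word_eval g v"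
  using word_eval_closed by (induction u) (auto simp: word_eval_def g m_assoc)

text \<open>Words outside the support contribute zero terms. Enlarging the index set lets
  polynomials with different supports be summed over a common one.\<close>

lemma fa_eval_superset:
  assumes "finite A" and "{w. f w \<noteq> 0} \<subseteq> A" and "\<And>w. w \<in> A \<Longrightarrow> set w \<subseteq> X"
  shows "fa_eval g f = (\<Oplus>w\<in>A. \<kappa> (f w) \<otimes> word_eval g w)"
  unfolding fa_eval_def
  by (rule add.finprod_mono_neutral_cong_left)
    (use assms in \<open>auto simp: word_eval_closed\<close>)

lemma fa_eval_closed [simp]: "f \<in> fa_carrier X \<Longrightarrow> fa_eval g f \<in> carrier R"
  unfolding fa_eval_def by (rule finsum_closed) (auto simp: fa_carrier_def word_eval_closed)

lemma fa_eval_add: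
  assumes f: "f \<in> fa_carrier X" and h: "h \<in> fa_carrier X"
  shows "fa_eval g (fa_add f h) = fa_eval g f \<oplus> fa_eval g h"
proof -
  define A where "A = {w. f w \<noteq> 0} \<union> {w. h w \<noteq> 0}"
  have A: "finite A" "\<And>w. w \<in> A \<Longrightarrow> set w \<subseteq> X"
    using f h by (auto simp: A_def fa_carrier_def)
  have "fa_eval g (fa_add f h) = (\<Oplus>w\<in>A. \<kappa> (fa_add f h w) \<otimes> word_eval g w)"
    by (rule fa_eval_superset) (use A in \<open>auto simp: A_def fa_add_def\<close>)
  also have "\<dots> = (\<Oplus>w\<in>A. \<kappa> (f w) \<otimes> word_eval g w \<oplus> \<kappa> (h w) \<otimes> word_eval g w)"
    by (rule finsum_cong') (use A word_eval_closed in \<open>auto simp: fa_add_def \<kappa>_add l_distr\<close>)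
  also have "\<dots> = (\<Oplus>w\<in>A. \<kappa> (f w) \<otimes> word_eval g w) \<oplus> (\<Oplus>w\<in>A. \<kappa> (h w) \<otimes> word_eval g w)"
    by (rule finsum_addf) (use A word_eval_closed in auto)
  also have "\<dots> = fa_eval g f \<oplus> fa_eval g h"
    using fa_eval_superset [of A f] fa_eval_superset [of A h] A by (simp add: A_def)
  finally show ?thesis .
qed

lemma fa_eval_zero [simp]: "fa_eval g (\<lambda>w. 0) = \<zero>"
  by (simp add: fa_eval_def)

lemma fa_eval_mono: "set u \<subseteq> X \<Longrightarrow> fa_eval g (fa_mono c u) = \<kappa> c \<otimes> word_eval g u"
  by (subst fa_eval_superset [of "{u}"])
    (auto simp: fa_mono_def word_eval_closed split: if_splits)

lemma fa_eval_gen: "x \<in> X \<Longrightarrow> fa_eval g (fa_gen x) = g x"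
  by (simp add: fa_gen_eq_mono fa_eval_mono) (simp add: word_eval_def g)

text \<open>First half of multiplicativity: the left factor is a monomial and the right one is built
  up additively. \<open>fa_eval_mult\<close> then builds up the left factor.\<close>

lemma fa_eval_mult_mono:
  assumes "f \<in> fa_carrier X" and u: "set u \<subseteq> X"
  shows "fa_eval g (fa_mult (fa_mono c u) f) = \<kappa> c \<otimes> word_eval g u \<otimes> fa_eval g f"
  using assms(1)
proof (induction rule: fa_carrier_induct)
  case zero
  have "fa_mult (fa_mono c u) (\<lambda>w. 0) = (\<lambda>w. 0)"
    by (simp add: fa_mult_def)
  then show ?case
    using u by (simp add: word_eval_closed)
next
  case (add f d v)
  note carr = fa_in_carrier fa_mono_in_carrier word_eval_closed
  \<comment> \<open>Centrality of scalars enters here: \<open>\<kappa> d\<close> has to pass the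
    value of the word \<open>u\<close>.\<close>
  have "\<kappa> (c * d) \<otimes> word_eval g (u @ v) = \<kappa> c \<otimes> word_eval g u \<otimes> (\<kappa> d \<otimes> word_eval g v)"
    using u add \<kappa>_left_commute [of "word_eval g u" "word_eval g v" d]
    by (simp add: \<kappa>_mult word_eval_append carr m_assoc)
  then show ?case
    using u add
    by (simp add: fa_mult_add_right fa_eval_add carr fa_mult_mono_mono fa_eval_mono r_distr)
qed

lemma fa_eval_mult:
  assumes "f \<in> fa_carrier X" and h: "h \<in> fa_carrier X"
  shows "fa_eval g (fa_mult f h) = fa_eval g f \<otimes> fa_eval g h"
  using assms(1)
proof (induction rule: fa_carrier_induct)
  case zero
  have "fa_mult (\<lambda>w. 0) h = (\<lambda>w. 0)"
    by (simp add: fa_mult_def)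
  then show ?case
    using h by simp
next
  case (add f d v)
  note carr = fa_in_carrier fa_mono_in_carrier word_eval_closed
  show ?case
    using add h
    by (simp add: fa_mult_add_left fa_eval_add carr fa_eval_mult_mono fa_eval_mono l_distr)
qed

lemma fa_eval_smult: "f \<in> fa_carrier X \<Longrightarrow> fa_eval g (fa_smult c f) = \<kappa> c \<otimes> fa_eval g f"
  using fa_eval_mult [OF fa_scal_in_carrier] by (metis fa_eval_scal fa_mult_scal_left)

lemma fa_eval_hom: "fa_eval g \<in> ring_hom (free_alg X) R"
  by (rule ring_hom_memI) (auto simp: fa_eval_add fa_eval_mult)

text \<open>Existence half of the universal property. The kernel of evaluation is an ideal
  containing the relators, hence contains the ideal they generate, so evaluation is constant on
  cosets.\<close>

lemma presented_alg_hom_exists: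
  assumes Rel: "Rel \<subseteq> fa_carrier X" and zero: "\<And>r. r \<in> Rel \<Longrightarrow> fa_eval g r = \<zero>"
  shows "\<exists>\<phi> \<in> ring_hom (presented_alg X Rel) R.
    \<forall>f \<in> fa_carrier X. \<phi> (pa_class X Rel f) = fa_eval g f"
proof -
  interpret F: ring "free_alg X :: ('x list \<Rightarrow> 'k) ring" by (rule ring_free_alg)
  interpret h: ring_hom_ring "free_alg X" R "fa_eval g"
    by (rule ring_hom_ringI2 [OF F.ring_axioms ring_axioms fa_eval_hom])
  define I where "I = genideal (free_alg X) Rel"
  interpret I: ideal I "free_alg X :: ('x list \<Rightarrow> 'k) ring"
    unfolding I_def by (rule F.genideal_ideal) (simp add: Rel)
  have "I \<subseteq> a_kernel (free_alg X) R (fa_eval g)"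
    unfolding I_def
  proof (rule F.genideal_minimal [OF h.kernel_is_ideal])
    show "Rel \<subseteq> a_kernel (free_alg X) R (fa_eval g)"
      unfolding a_kernel_def' using Rel zero by (simp add: subset_iff)
  qed
  then have ker: "fa_eval g i = \<zero>" if "i \<in> I" for i
    using subsetD [OF _ that] unfolding a_kernel_def' by blast
  \<comment> \<open>The image of a coset under evaluation will be a singleton; its element is the
    value of the induced map, with no choice of representatives.\<close>
  define \<phi> where "\<phi> C = the_elem (fa_eval g ` C)" for C
  have \<phi>: "\<phi> (I +>\<^bsub>free_alg X\<^esub> f) = fa_eval g f" if f: "f \<in> fa_carrier X" for f
  proof -
    have "fa_eval g h = fa_eval g f" if "h \<in> I +>\<^bsub>free_alg X\<^esub> f" for h
    proof -
      obtain i where "i \<in> I" "h = fa_add i f"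
        using \<open>h \<in> I +>\<^bsub>free_alg X\<^esub> f\<close> by (auto simp: a_r_coset_def')
      then show ?thesis
        using f I.a_Hcarr ker by (simp add: fa_eval_add)
    qed
    moreover have "f \<in> I +>\<^bsub>free_alg X\<^esub> f"
      using f by (simp add: I.a_rcos_self)
    ultimately have "fa_eval g ` (I +>\<^bsub>free_alg X\<^esub> f) = {fa_eval g f}"
      by blast
    then show ?thesis
      by (simp add: \<phi>_def)
  qed
  then have \<phi>_class: "\<phi> (pa_class X Rel f) = fa_eval g f" if "f \<in> fa_carrier X" for f
    using that by (simp add: pa_class_def I_def)
  have "\<phi> \<in> ring_hom (presented_alg X Rel) R"
  proof (rule ring_hom_memI)
    show "\<phi> r \<in> carrier R" if r: "r \<in> carrier (presented_alg X Rel)" for r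
      by (rule pa_class_surj [OF Rel r]) (simp add: \<phi>_class)
    fix r s
    assume "r \<in> carrier (presented_alg X Rel)" "s \<in> carrier (presented_alg X Rel)"
    then obtain f h where "f \<in> fa_carrier X" "r = pa_class X Rel f"
      and "h \<in> fa_carrier X" "s = pa_class X Rel h"
      by (metis pa_class_surj [OF Rel])
    then show "\<phi> (r \<otimes>\<^bsub>presented_alg X Rel\<^esub> s) = \<phi> r \<otimes> \<phi> s"
      and "\<phi> (r \<oplus>\<^bsub>presented_alg X Rel\<^esub> s) = \<phi> r \<oplus> \<phi> s"
      by (simp_all add: \<phi>_class fa_in_carrier fa_eval_add fa_eval_mult
          flip: pa_class_add [OF Rel] pa_class_mult [OF Rel])
  next
    show "\<phi> \<one>\<^bsub>presented_alg X Rel\<^esub> = \<one>"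
      by (simp add: \<phi>_class fa_in_carrier flip: pa_class_one [OF Rel])
  qed
  then show ?thesis
    using \<phi>_class by blast
qed

end

end

section \<open>Presented algebras as algebras over the field, and a criterion for their
  isomorphism\<close>

context
  fixes X :: "'x set" and Rel :: "('x list \<Rightarrow> 'a::field) set"
  assumes Rel: "Rel \<subseteq> fa_carrier X"
begin

text \<open>Multiplying by a scalar from either side is \<open>fa_smult\<close> already in the free
  algebra, so scalars stay central in the quotient.\<close>

lemma k_algebra_presented_alg: "k_algebra (presented_alg X Rel) (pa_scal X Rel)"
proof -
  interpret ring "presented_alg X Rel" by (rule ring_presented_alg [OF Rel])
  note carr = fa_scal_in_carrier [of _ X]
  show ?thesis
  proof
    show "pa_scal X Rel c \<in> carrier (presented_alg X Rel)" for c
      by (simp add: pa_scal_eq_class pa_class_closed [OF Rel] carr)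
    show "pa_scal X Rel 1 = \<one>\<^bsub>presented_alg X Rel\<^esub>"
      using ring_hom_one [OF pa_class_hom [OF Rel]] by (simp add: pa_scal_eq_class)
    fix c d
    have "fa_scal (c + d) = fa_add (fa_scal c) (fa_scal d :: 'x list \<Rightarrow> 'a)"
      by (auto simp: fa_scal_def fa_add_def)
    then show "pa_scal X Rel (c + d) =
        pa_scal X Rel c \<oplus>\<^bsub>presented_alg X Rel\<^esub> pa_scal X Rel d"
      by (simp add: pa_scal_eq_class pa_class_add [OF Rel] carr)
    have "fa_scal (c * d) = fa_mult (fa_scal c) (fa_scal d :: 'x list \<Rightarrow> 'a)"
      by (simp add: fa_scal_eq_mono fa_mult_mono_mono)
    then show "pa_scal X Rel (c * d) =
        pa_scal X Rel c \<otimes>\<^bsub>presented_alg X Rel\<^esub> pa_scal X Rel d"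
      by (simp add: pa_scal_eq_class pa_class_mult [OF Rel] carr)
  next
    fix r c
    assume "r \<in> carrier (presented_alg X Rel)"
    then obtain f where "f \<in> fa_carrier X" and "r = pa_class X Rel f"
      by (rule pa_class_surj [OF Rel])
    then show "r \<otimes>\<^bsub>presented_alg X Rel\<^esub> pa_scal X Rel c =
        pa_scal X Rel c \<otimes>\<^bsub>presented_alg X Rel\<^esub> r"
      by (simp add: pa_scal_eq_class carr fa_mult_scal_left fa_mult_scal_right
          flip: pa_class_mult [OF Rel])
  qed
qed

text \<open>Uniqueness half of the universal property: composed with the quotient map,
  \<open>F\<close> and the identity become homomorphisms on the free algebra to which
  \<open>fa_hom_unique\<close> applies.\<close>

lemma presented_alg_endo_id:
  assumes F: "F \<in> ring_hom (presented_alg X Rel) (presented_alg X Rel)"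
    and "\<And>c. F (pa_scal X Rel c) = pa_scal X Rel c"
    and "\<And>x. x \<in> X \<Longrightarrow> F (pa_class X Rel (fa_gen x)) = pa_class X Rel (fa_gen x)"
    and "r \<in> carrier (presented_alg X Rel)"
  shows "F r = r"
proof -
  obtain f where f: "f \<in> fa_carrier X" "r = pa_class X Rel f"
    using assms(4) by (rule pa_class_surj [OF Rel])
  have "(F \<circ> pa_class X Rel) f = pa_class X Rel f"
    by (rule fa_hom_unique [OF ring_hom_trans [OF pa_class_hom [OF Rel] F] pa_class_hom [OF Rel] _ _ f(1)])
      (use assms(2,3) in \<open>auto simp: pa_scal_eq_class\<close>)
  then show ?thesis
    by (simp add: f(2))
qed

end

text \<open>Isomorphism by substitution of generators. \<open>gR\<close> and \<open>hS\<close> make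
  the substitutions \<open>g\<close> and \<open>h\<close> descend to the quotients;
  \<open>gh\<close> and \<open>hg\<close> make both composites fix the generators, hence be
  identities.\<close>

lemma alg_isomorphicI:
  fixes R :: "('x list \<Rightarrow> 'a::field) set" and S :: "('y list \<Rightarrow> 'a) set"
  assumes R: "R \<subseteq> fa_carrier X" and S: "S \<subseteq> fa_carrier Y"
    and g: "\<And>x. x \<in> X \<Longrightarrow> g x \<in> fa_carrier Y"
    and h: "\<And>y. y \<in> Y \<Longrightarrow> h y \<in> fa_carrier X"
    and gR: "\<And>r. r \<in> R \<Longrightarrow>
      k_algebra.fa_eval (presented_alg Y S) (pa_scal Y S) (pa_class Y S \<circ> g) r = \<zero>\<^bsub>presented_alg Y S\<^esub>"
    and hS: "\<And>s. s \<in> S \<Longrightarrow>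
      k_algebra.fa_eval (presented_alg X R) (pa_scal X R) (pa_class X R \<circ> h) s = \<zero>\<^bsub>presented_alg X R\<^esub>"
    and gh: "\<And>y. y \<in> Y \<Longrightarrow>
      k_algebra.fa_eval (presented_alg Y S) (pa_scal Y S) (pa_class Y S \<circ> g) (h y) = pa_class Y S (fa_gen y)"
    and hg: "\<And>x. x \<in> X \<Longrightarrow>
      k_algebra.fa_eval (presented_alg X R) (pa_scal X R) (pa_class X R \<circ> h) (g x) = pa_class X R (fa_gen x)"
  shows "alg_isomorphic X R Y S"
proof -
  interpret A: k_algebra "presented_alg X R" "pa_scal X R" by (rule k_algebra_presented_alg [OF R])
  interpret B: k_algebra "presented_alg Y S" "pa_scal Y S" by (rule k_algebra_presented_alg [OF S])
  have g': "(pa_class Y S \<circ> g) x \<in> carrier (presented_alg Y S)" if "x \<in> X" for x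
    using g that by (simp add: pa_class_closed [OF S])
  have h': "(pa_class X R \<circ> h) y \<in> carrier (presented_alg X R)" if "y \<in> Y" for y
    using h that by (simp add: pa_class_closed [OF R])
  obtain \<phi> where \<phi>: "\<phi> \<in> ring_hom (presented_alg X R) (presented_alg Y S)"
    and \<phi>_class: "\<And>f. f \<in> fa_carrier X \<Longrightarrow> \<phi> (pa_class X R f) = B.fa_eval (pa_class Y S \<circ> g) f"
    using B.presented_alg_hom_exists [OF g' R gR] by blast
  obtain \<psi> where \<psi>: "\<psi> \<in> ring_hom (presented_alg Y S) (presented_alg X R)"
    and \<psi>_class: "\<And>f. f \<in> fa_carrier Y \<Longrightarrow>
      \<psi> (pa_class Y S f) = A.fa_eval (pa_class X R \<circ> h) f"
    using A.presented_alg_hom_exists [OF h' S hS] by blast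
  have \<phi>_scal: "\<phi> (pa_scal X R c) = pa_scal Y S c" for c
    using \<phi>_class [OF fa_scal_in_carrier]
    by (simp add: pa_scal_eq_class)
  have \<psi>_scal: "\<psi> (pa_scal Y S c) = pa_scal X R c" for c
    using \<psi>_class [OF fa_scal_in_carrier]
    by (simp add: pa_scal_eq_class)
  have \<psi>_gen: "\<psi> (pa_class Y S (fa_gen y)) = pa_class X R (h y)" if "y \<in> Y" for y
    using that A.fa_eval_gen [where g = "pa_class X R \<circ> h", OF h'] by (simp add: \<psi>_class fa_gen_in_carrier)
  have \<psi>\<phi>: "\<psi> (\<phi> r) = r" if "r \<in> carrier (presented_alg X R)" for r
  proof -
    have "(\<psi> \<circ> \<phi>) (pa_class X R (fa_gen x)) = pa_class X R (fa_gen x)" if "x \<in> X" for x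
      using that B.fa_eval_gen [where g = "pa_class Y S \<circ> g", OF g'] g hg
      by (simp add: \<phi>_class \<psi>_class fa_gen_in_carrier)
    then have "(\<psi> \<circ> \<phi>) r = r"
      by (intro presented_alg_endo_id [OF R ring_hom_trans [OF \<phi> \<psi>] _ _ that])
        (auto simp: \<phi>_scal \<psi>_scal)
    then show ?thesis by simp
  qed
  have \<phi>\<psi>: "\<phi> (\<psi> r) = r" if "r \<in> carrier (presented_alg Y S)" for r
  proof -
    have "(\<phi> \<circ> \<psi>) (pa_class Y S (fa_gen y)) = pa_class Y S (fa_gen y)" if "y \<in> Y" for y
      using that gh h by (simp add: \<psi>_gen \<phi>_class)
    then have "(\<phi> \<circ> \<psi>) r = r"
      by (intro presented_alg_endo_id [OF S ring_hom_trans [OF \<psi> \<phi>] _ _ that])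
        (auto simp: \<phi>_scal \<psi>_scal)
    then show ?thesis by simp
  qed
  have "bij_betw \<phi> (carrier (presented_alg X R)) (carrier (presented_alg Y S))"
    by (rule bij_betw_byWitness [where f' = \<psi>])
      (use \<phi> \<psi> \<phi>\<psi> \<psi>\<phi> in \<open>auto simp: ring_hom_closed\<close>)
  then show ?thesis
    using \<phi> \<phi>_scal unfolding alg_isomorphic_def ring_iso_def by blast
qed

section \<open>Twists of Clifford generators\<close>

context k_algebra
begin

lemma \<kappa>_uminus_mult: "r \<in> carrier R \<Longrightarrow> \<kappa> (- c) \<otimes> r = \<ominus> (\<kappa> c \<otimes> r)"
  by (simp add: \<kappa>_uminus l_minus)

text \<open>Multiply by the inverse of 2 in the field. The 2 is written as \<open>1 + 1\<close> so
  that \<open>\<kappa>_add\<close> splits it.\<close>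

lemma double_eq_zero:
  assumes "(2::'k) \<noteq> 0" and r: "r \<in> carrier R" and "r \<oplus> r = \<zero>"
  shows "r = \<zero>"
proof -
  have "r = \<kappa> (inverse 2 * (1 + 1)) \<otimes> r"
    using assms(1) r by simp
  also have "\<dots> = \<kappa> (inverse 2) \<otimes> (r \<oplus> r)"
    unfolding \<kappa>_mult \<kappa>_add using r by (simp add: m_assoc l_distr)
  finally show ?thesis
    using assms(3) by simp
qed

lemma add_eq_zeroD: "r \<in> carrier R \<Longrightarrow> s \<in> carrier R \<Longrightarrow> r \<oplus> s = \<zero> \<Longrightarrow> r = \<ominus> s"
  by (simp add: minus_equality)

lemma add_uminus_eq_zeroD: "r \<in> carrier R \<Longrightarrow> s \<in> carrier R \<Longrightarrow> r \<oplus> \<ominus> s = \<zero> \<Longrightarrow> r = s"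
  using add_eq_zeroD [of r "\<ominus> s"] by simp

text \<open>Moving \<open>u\<close> past \<open>y\<close> and then past \<open>x\<close> changes the
  sign twice.\<close>

lemma anticommuting_pair_commutes:
  assumes carr: "x \<in> carrier R" "y \<in> carrier R" "u \<in> carrier R"
    and "x \<otimes> u \<oplus> u \<otimes> x = \<zero>" and "y \<otimes> u \<oplus> u \<otimes> y = \<zero>"
  shows "x \<otimes> y \<otimes> u = u \<otimes> (x \<otimes> y)"
proof -
  have xu: "x \<otimes> u = \<ominus> (u \<otimes> x)" and yu: "y \<otimes> u = \<ominus> (u \<otimes> y)"
    using assms by (simp_all add: add_eq_zeroD)
  have "x \<otimes> y \<otimes> u = \<ominus> (x \<otimes> u \<otimes> y)"
    using carr by (simp add: m_assoc yu r_minus)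
  also have "\<dots> = u \<otimes> (x \<otimes> y)"
    using carr by (simp add: xu l_minus m_assoc)
  finally show ?thesis .
qed

text \<open>The candidate for \<omega>, with \<open>p\<close> in the role of
  \<open>inverse q\<close>. Under the relations assumed below it has eigenvalue 1 on the idempotent
  \<open>x \<otimes> y\<close> and \<open>p\<close> on \<open>y \<otimes> x\<close>.\<close>

definition twist :: "'k \<Rightarrow> 'a \<Rightarrow> 'a \<Rightarrow> 'a" where
  "twist p x y = x \<otimes> y \<oplus> \<kappa> p \<otimes> (y \<otimes> x)"

lemma twist_closed [simp]: "x \<in> carrier R \<Longrightarrow> y \<in> carrier R \<Longrightarrow> twist p x y \<in> carrier R"
  by (simp add: twist_def)

lemma twist_commutes:
  assumes carr: "x \<in> carrier R" "y \<in> carrier R" "u \<in> carrier R"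
    and "x \<otimes> y \<otimes> u = u \<otimes> (x \<otimes> y)" and "y \<otimes> x \<otimes> u = u \<otimes> (y \<otimes> x)"
  shows "twist p x y \<otimes> u = u \<otimes> twist p x y"
  unfolding twist_def using assms
  by (simp add: l_distr r_distr \<kappa>_left_commute m_assoc [of "\<kappa> p"])

lemma twist_commutes_anticommuting:
  assumes "x \<in> carrier R" "y \<in> carrier R" "u \<in> carrier R"
    and "x \<otimes> u \<oplus> u \<otimes> x = \<zero>" and "y \<otimes> u \<oplus> u \<otimes> y = \<zero>"
  shows "twist p x y \<otimes> u = u \<otimes> twist p x y"
  using assms by (intro twist_commutes anticommuting_pair_commutes)

context
  fixes x y :: 'a
  assumes carr [simp]: "x \<in> carrier R" "y \<in> carrier R"
    and xx: "x \<otimes> x = \<zero>" and yy: "y \<otimes> y = \<zero>" and xy: "x \<otimes> y \<oplus> y \<otimes> x = \<one>"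
begin

text \<open>Multiply \<open>xy\<close> by \<open>x\<close> on the left; the term containing the
  square of \<open>x\<close> vanishes.\<close>

lemma x_y_x: "x \<otimes> (y \<otimes> x) = x"
proof -
  have "x = x \<otimes> (x \<otimes> y \<oplus> y \<otimes> x)"
    by (simp add: xy)
  also have "\<dots> = x \<otimes> x \<otimes> y \<oplus> x \<otimes> (y \<otimes> x)"
    by (simp add: r_distr m_assoc)
  finally show ?thesis
    by (simp add: xx)
qed

lemma y_x_y: "y \<otimes> (x \<otimes> y) = y"
proof -
  have "y = y \<otimes> (x \<otimes> y \<oplus> y \<otimes> x)"
    by (simp add: xy)
  also have "\<dots> = y \<otimes> (x \<otimes> y) \<oplus> y \<otimes> y \<otimes> x"
    by (simp add: r_distr m_assoc)
  finally show ?thesis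
    by (simp add: yy)
qed

text \<open>In each of the four one-sided products one term of the twist dies by a square and the
  other collapses by \<open>x_y_x\<close> or \<open>y_x_y\<close>. Comparing left and right products
  yields the q-commutation rules.\<close>

lemma twist_mult_x: "twist p x y \<otimes> x = x"
  by (simp add: twist_def l_distr m_assoc x_y_x xx)

lemma twist_mult_y: "twist p x y \<otimes> y = \<kappa> p \<otimes> y"
  by (simp add: twist_def l_distr m_assoc y_x_y yy)

lemma x_mult_twist: "x \<otimes> twist p x y = \<kappa> p \<otimes> x"
proof -
  have "x \<otimes> (x \<otimes> y) = \<zero>"
    by (simp add: xx flip: m_assoc)
  then show ?thesis
    by (simp add: twist_def r_distr \<kappa>_left_commute x_y_x)
qed

lemma y_mult_twist: "y \<otimes> twist p x y = y"
proof -
  have "y \<otimes> (y \<otimes> x) = \<zero>"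
    by (simp add: yy flip: m_assoc)
  then show ?thesis
    by (simp add: twist_def r_distr \<kappa>_left_commute y_x_y)
qed

text \<open>This is the expanded form of (t - 1)(t - p) = 0 for the twist t, whose eigenvalues are 1
  and \<open>p\<close>.\<close>

lemma twist_square:
  "twist p x y \<otimes> twist p x y \<oplus> \<kappa> (- (1 + p)) \<otimes> twist p x y \<oplus> \<kappa> p = \<zero>"
proof -
  \<comment> \<open>Only the right factor is expanded, so that the left one can act on
    \<open>x\<close> and \<open>y\<close>.\<close>
  have "twist p x y \<otimes> twist p x y = twist p x y \<otimes> x \<otimes> y \<oplus> \<kappa> p \<otimes> (twist p x y \<otimes> y \<otimes> x)"
    by (subst (2) twist_def) (simp add: r_distr \<kappa>_left_commute m_assoc)
  also have "\<dots> = x \<otimes> y \<oplus> \<kappa> p \<otimes> (\<kappa> p \<otimes> (y \<otimes> x))"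
    by (simp add: twist_mult_x twist_mult_y m_assoc)
  \<comment> \<open>The constant \<open>\<kappa> p\<close> is spread over the two idempotents by
    means of \<open>xy\<close>, which makes the right side a multiple of the twist.\<close>
  finally have "twist p x y \<otimes> twist p x y \<oplus> \<kappa> p
      = x \<otimes> y \<oplus> \<kappa> p \<otimes> (\<kappa> p \<otimes> (y \<otimes> x)) \<oplus> \<kappa> p \<otimes> (x \<otimes> y \<oplus> y \<otimes> x)"
    by (simp add: xy)
  also have "\<dots> = \<kappa> (1 + p) \<otimes> twist p x y"
    unfolding twist_def by (simp add: \<kappa>_add l_distr r_distr a_ac)
  finally have eq: "twist p x y \<otimes> twist p x y \<oplus> \<kappa> p = \<kappa> (1 + p) \<otimes> twist p x y" .
  have "\<kappa> (- (1 + p)) \<otimes> twist p x y = \<ominus> (\<kappa> (1 + p) \<otimes> twist p x y)"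
    by (rule \<kappa>_uminus_mult) simp
  then have "twist p x y \<otimes> twist p x y \<oplus> \<kappa> (- (1 + p)) \<otimes> twist p x y \<oplus> \<kappa> p
      = twist p x y \<otimes> twist p x y \<oplus> \<kappa> p \<oplus> \<ominus> (\<kappa> (1 + p) \<otimes> twist p x y)"
    by (simp add: a_ac)
  also have "\<dots> = \<zero>"
    unfolding eq by (simp add: r_neg)
  finally show ?thesis .
qed

end

end

text \<open>The classical Clifford relations for a family in an arbitrary algebra. The mixed
  relation is split by equality of indices, which removes the Kronecker delta.\<close>

locale clifford_generators = k_algebra R \<kappa> for R (structure) and \<kappa> :: "'k::field \<Rightarrow> 'a" +
  fixes A :: "'i set" and v v' :: "'i \<Rightarrow> 'a"
  assumes char_neq_2: "(2::'k) \<noteq> 0"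
    and v_closed [simp]: "a \<in> A \<Longrightarrow> v a \<in> carrier R"
    and v'_closed [simp]: "a \<in> A \<Longrightarrow> v' a \<in> carrier R"
    and v_v: "a \<in> A \<Longrightarrow> b \<in> A \<Longrightarrow> v a \<otimes> v b \<oplus> v b \<otimes> v a = \<zero>"
    and v'_v': "a \<in> A \<Longrightarrow> b \<in> A \<Longrightarrow> v' a \<otimes> v' b \<oplus> v' b \<otimes> v' a = \<zero>"
    and v_v'_same: "a \<in> A \<Longrightarrow> v a \<otimes> v' a \<oplus> v' a \<otimes> v a = \<one>"
    and v_v': "a \<in> A \<Longrightarrow> b \<in> A \<Longrightarrow> a \<noteq> b \<Longrightarrow> v a \<otimes> v' b \<oplus> v' b \<otimes> v a = \<zero>"
begin

text \<open>The anticommutation relation with equal indices only says that twice the square is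
  zero.\<close>

lemma v_square: "a \<in> A \<Longrightarrow> v a \<otimes> v a = \<zero>"
  by (rule double_eq_zero [OF char_neq_2]) (auto simp: v_v)

lemma v'_square: "a \<in> A \<Longrightarrow> v' a \<otimes> v' a = \<zero>"
  by (rule double_eq_zero [OF char_neq_2]) (auto simp: v'_v')

lemma v'_v: "a \<in> A \<Longrightarrow> b \<in> A \<Longrightarrow> a \<noteq> b \<Longrightarrow> v' a \<otimes> v b \<oplus> v b \<otimes> v' a = \<zero>"
  using v_v' [of b a] by (simp add: a_comm)

lemmas pair_rules = v_closed v'_closed v_square v'_square v_v'_same

text \<open>The twist fixes \<open>v a\<close> from the left and scales it by
  \<open>inverse q\<close> from the right; the factor \<open>q\<close> compensates.\<close>

lemma twist_v_same:
  assumes "q \<noteq> 0" and a: "a \<in> A"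
  shows "twist (inverse q) (v a) (v' a) \<otimes> v a = \<kappa> q \<otimes> (v a \<otimes> twist (inverse q) (v a) (v' a))"
proof -
  have "\<kappa> q \<otimes> (\<kappa> (inverse q) \<otimes> v a) = v a"
    using assms by (simp flip: m_assoc \<kappa>_mult)
  then show ?thesis
    using a by (simp add: twist_mult_x x_mult_twist pair_rules)
qed

lemma twist_v'_same:
  "a \<in> A \<Longrightarrow> twist p (v a) (v' a) \<otimes> v' a = \<kappa> p \<otimes> (v' a \<otimes> twist p (v a) (v' a))"
  by (simp add: twist_mult_y y_mult_twist pair_rules)

lemma twist_v:
  "a \<in> A \<Longrightarrow> b \<in> A \<Longrightarrow> a \<noteq> b \<Longrightarrow> twist p (v a) (v' a) \<otimes> v b = v b \<otimes> twist p (v a) (v' a)"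
  by (intro twist_commutes_anticommuting) (simp_all add: v_v v'_v)

lemma twist_v':
  "a \<in> A \<Longrightarrow> b \<in> A \<Longrightarrow> a \<noteq> b \<Longrightarrow> twist p (v a) (v' a) \<otimes> v' b = v' b \<otimes> twist p (v a) (v' a)"
  by (intro twist_commutes_anticommuting) (simp_all add: v'_v' v_v')

text \<open>For distinct indices one twist commutes with both generators of the other index, hence
  with their products and with the other twist.\<close>

lemma twist_twist:
  assumes a: "a \<in> A" and b: "b \<in> A"
  shows "twist p (v a) (v' a) \<otimes> twist p (v b) (v' b) = twist p (v b) (v' b) \<otimes> twist p (v a) (v' a)"
proof (cases "a = b")
  case False
  let ?w = "twist p (v a) (v' a)"
  have prod: "r \<otimes> s \<otimes> ?w = ?w \<otimes> (r \<otimes> s)"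
    if "?w \<otimes> r = r \<otimes> ?w" "?w \<otimes> s = s \<otimes> ?w" "r \<in> carrier R" "s \<in> carrier R" for r s
    using that a by (metis m_assoc twist_closed v_closed v'_closed)
  have "twist p (v b) (v' b) \<otimes> ?w = ?w \<otimes> twist p (v b) (v' b)"
    by (rule twist_commutes) (simp_all add: a b False twist_v twist_v' prod)
  then show ?thesis
    by simp
qed simp

lemma twist_v_square:
  "a \<in> A \<Longrightarrow> twist p (v a) (v' a) \<otimes> twist p (v a) (v' a)
    \<oplus> \<kappa> (- (1 + p)) \<otimes> twist p (v a) (v' a) \<oplus> \<kappa> p = \<zero>"
  by (rule twist_square) (auto simp: pair_rules)

end

section \<open>The two presentations\<close>

lemma qgensE:
  assumes "x \<in> qgens n"
  obtains a where "a \<in> {1..n}" "x = Om a" | a where "a \<in> {1..n}" "x = Ph a"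
    | a where "a \<in> {1..n}" "x = PhS a"
  using assms by (auto simp: qgens_def)

lemma cgensE:
  assumes "y \<in> cgens n"
  obtains a where "a \<in> {1..n}" "y = V a" | a where "a \<in> {1..n}" "y = VS a"
  using assms by (auto simp: cgens_def)

lemma clq_rels_in_carrier: "clq_rels q n \<subseteq> fa_carrier (qgens n)"
proof -
  have "Om a \<in> qgens n" "Ph a \<in> qgens n" "PhS a \<in> qgens n" if "a \<in> {1..n}" for a
    using that by (auto simp: qgens_def)
  then show ?thesis
    unfolding clq_rels_def by (intro UN_least) (simp add: fa_in_carrier)
qed

lemma cl_rels_in_carrier: "cl_rels n \<subseteq> fa_carrier (cgens n)"
proof -
  have "V a \<in> cgens n" "VS a \<in> cgens n" if "a \<in> {1..n}" for a
    using that by (auto simp: cgens_def)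
  then show ?thesis
    unfolding cl_rels_def by (intro UN_least) (simp add: fa_in_carrier)
qed

section \<open>The substitutions in both directions and the isomorphism\<close>

definition cl_of_q :: "'a::field \<Rightarrow> qgen \<Rightarrow> cgen list \<Rightarrow> 'a" where
  "cl_of_q q x = (case x of
      Om a \<Rightarrow> fa_add (fa_mult (fa_gen (V a)) (fa_gen (VS a)))
        (fa_smult (inverse q) (fa_mult (fa_gen (VS a)) (fa_gen (V a))))
    | Ph a \<Rightarrow> fa_gen (V a)
    | PhS a \<Rightarrow> fa_gen (VS a))"

definition q_of_cl :: "cgen \<Rightarrow> qgen list \<Rightarrow> 'a::field" where
  "q_of_cl y = (case y of V a \<Rightarrow> fa_gen (Ph a) | VS a \<Rightarrow> fa_gen (PhS a))"

theorem theorem5p3: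
  fixes q :: "'a::field" and n :: nat
  assumes "(2::'a) \<noteq> 0" and "q \<noteq> 0" and "n \<ge> 1"
  shows "alg_isomorphic (qgens n) (clq_rels q n) (cgens n) (cl_rels n :: (cgen list \<Rightarrow> 'a) set)"
proof -
  let ?X = "qgens n" and ?R = "clq_rels q n" and ?Y = "cgens n"
    and ?S = "cl_rels n :: (cgen list \<Rightarrow> 'a) set"
  note RX = clq_rels_in_carrier [of q n] and SY = cl_rels_in_carrier [of n, where 'a = 'a]
  interpret A: k_algebra "presented_alg ?X ?R" "pa_scal ?X ?R"
    by (rule k_algebra_presented_alg [OF RX])
  interpret B: k_algebra "presented_alg ?Y ?S" "pa_scal ?Y ?S"
    by (rule k_algebra_presented_alg [OF SY])
  define v where "v a = pa_class ?Y ?S (fa_gen (V a))" for a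
  define v' where "v' a = pa_class ?Y ?S (fa_gen (VS a))" for a
  define om where "om a = pa_class ?X ?R (fa_gen (Om a))" for a
  define ph where "ph a = pa_class ?X ?R (fa_gen (Ph a))" for a
  define ph' where "ph' a = pa_class ?X ?R (fa_gen (PhS a))" for a
  have X [simp]: "Om a \<in> ?X" "Ph a \<in> ?X" "PhS a \<in> ?X" if "a \<in> {1..n}" for a
    using that by (auto simp: qgens_def)
  have Y [simp]: "V a \<in> ?Y" "VS a \<in> ?Y" if "a \<in> {1..n}" for a
    using that by (auto simp: cgens_def)
  \<comment> \<open>These rules push the quotient map through a polynomial, turning the class of a
    relator into an expression in the generator classes.\<close>
  note classB = pa_class_add [OF SY] pa_class_mult [OF SY] pa_class_smult [OF SY]
    pa_scal_eq_class [symmetric] v_def [symmetric] v'_def [symmetric] fa_in_carrier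
  note classA = pa_class_add [OF RX] pa_class_mult [OF RX] pa_class_smult [OF RX]
    pa_scal_eq_class [symmetric] om_def [symmetric] ph_def [symmetric] ph'_def [symmetric] fa_in_carrier
  have clA [simp]: "om a \<in> carrier (presented_alg ?X ?R)" "ph a \<in> carrier (presented_alg ?X ?R)"
    "ph' a \<in> carrier (presented_alg ?X ?R)" if "a \<in> {1..n}" for a
    using that by (simp_all add: om_def ph_def ph'_def pa_class_closed [OF RX] fa_in_carrier)
  have clB: "v a \<in> carrier (presented_alg ?Y ?S)" "v' a \<in> carrier (presented_alg ?Y ?S)"
    if "a \<in> {1..n}" for a
    using that by (simp_all add: v_def v'_def pa_class_closed [OF SY] fa_in_carrier)
  have relB: "r \<in> ?S \<Longrightarrow> pa_class ?Y ?S r = \<zero>\<^bsub>presented_alg ?Y ?S\<^esub>" for r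
    by (rule pa_class_rel [OF SY])
  have relA: "r \<in> ?R \<Longrightarrow> pa_class ?X ?R r = \<zero>\<^bsub>presented_alg ?X ?R\<^esub>" for r
    by (rule pa_class_rel [OF RX])

  interpret B: clifford_generators "presented_alg ?Y ?S" "pa_scal ?Y ?S" "{1..n}" v v'
  proof
    fix a b
    assume a: "a \<in> {1..n}"
    show "v a \<in> carrier (presented_alg ?Y ?S)" "v' a \<in> carrier (presented_alg ?Y ?S)"
      using a by (rule clB)+
    \<comment> \<open>With equal indices the delta is 1, so the scalar term is minus one and moves
      to the other side.\<close>
    have "fa_gen (V a) ** fa_gen (VS a) ++ fa_gen (VS a) ** fa_gen (V a)
        ++ fa_scal (- of_nat (delta a a)) \<in> ?S"
      using a unfolding cl_rels_def by blast
    from relB [OF this] show "v a \<otimes>\<^bsub>presented_alg ?Y ?S\<^esub> v' a \<oplus>\<^bsub>presented_alg ?Y ?S\<^esub>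
        v' a \<otimes>\<^bsub>presented_alg ?Y ?S\<^esub> v a = \<one>\<^bsub>presented_alg ?Y ?S\<^esub>"
      using a clB
      by - (rule B.add_uminus_eq_zeroD, simp_all add: classB delta_def B.\<kappa>_uminus)
    assume b: "b \<in> {1..n}"
    have "fa_gen (V a) ** fa_gen (V b) ++ fa_gen (V b) ** fa_gen (V a) \<in> ?S"
      using a b unfolding cl_rels_def by blast
    from relB [OF this] show "v a \<otimes>\<^bsub>presented_alg ?Y ?S\<^esub> v b \<oplus>\<^bsub>presented_alg ?Y ?S\<^esub>
        v b \<otimes>\<^bsub>presented_alg ?Y ?S\<^esub> v a = \<zero>\<^bsub>presented_alg ?Y ?S\<^esub>"
      using a b by (simp add: classB)
    have "fa_gen (VS a) ** fa_gen (VS b) ++ fa_gen (VS b) ** fa_gen (VS a) \<in> ?S"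
      using a b unfolding cl_rels_def by blast
    from relB [OF this] show "v' a \<otimes>\<^bsub>presented_alg ?Y ?S\<^esub> v' b \<oplus>\<^bsub>presented_alg ?Y ?S\<^esub>
        v' b \<otimes>\<^bsub>presented_alg ?Y ?S\<^esub> v' a = \<zero>\<^bsub>presented_alg ?Y ?S\<^esub>"
      using a b by (simp add: classB)
    assume "a \<noteq> b"
    have "fa_gen (V a) ** fa_gen (VS b) ++ fa_gen (VS b) ** fa_gen (V a)
        ++ fa_scal (- of_nat (delta a b)) \<in> ?S"
      using a b unfolding cl_rels_def by blast
    from relB [OF this] show "v a \<otimes>\<^bsub>presented_alg ?Y ?S\<^esub> v' b \<oplus>\<^bsub>presented_alg ?Y ?S\<^esub>
        v' b \<otimes>\<^bsub>presented_alg ?Y ?S\<^esub> v a = \<zero>\<^bsub>presented_alg ?Y ?S\<^esub>"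
      using a b \<open>a \<noteq> b\<close> by (simp add: classB delta_def clB)
  qed (rule assms(1))

  let ?g = "pa_class ?Y ?S \<circ> cl_of_q q" and ?h = "pa_class ?X ?R \<circ> q_of_cl"
  have g_carr: "cl_of_q q x \<in> fa_carrier ?Y" if "x \<in> ?X" for x
    using that by (elim qgensE) (simp_all add: cl_of_q_def fa_in_carrier)
  have h_carr: "q_of_cl y \<in> (fa_carrier ?X :: (qgen list \<Rightarrow> 'a) set)" if "y \<in> ?Y" for y
    using that by (elim cgensE) (simp_all add: q_of_cl_def fa_in_carrier)
  have g_closed: "?g x \<in> carrier (presented_alg ?Y ?S)" if "x \<in> ?X" for x
    using g_carr that by (simp add: pa_class_closed [OF SY])
  have h_closed: "?h y \<in> carrier (presented_alg ?X ?R)" if "y \<in> ?Y" for y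
    using h_carr that by (simp add: pa_class_closed [OF RX])
  have g_Om: "?g (Om a) = B.twist (inverse q) (v a) (v' a)" if "a \<in> {1..n}" for a
    using that by (simp add: cl_of_q_def classB B.twist_def)
  have g_Ph: "?g (Ph a) = v a" and g_PhS: "?g (PhS a) = v' a" for a
    by (simp_all add: cl_of_q_def v_def v'_def)
  have h_V: "?h (V a) = ph a" and h_VS: "?h (VS a) = ph' a" for a
    by (simp_all add: q_of_cl_def ph_def ph'_def)
  \<comment> \<open>The value rules are stated for the unexpanded composite \<open>?g\<close>; this
    is why \<open>o_apply\<close> is removed from the simpset wherever they are used. The same holds
    for \<open>?h\<close>.\<close>
  note evalB = B.fa_eval_add [of ?X ?g, OF g_closed] B.fa_eval_mult [of ?X ?g, OF g_closed]
    B.fa_eval_smult [of ?X ?g, OF g_closed] B.fa_eval_gen [of ?X ?g, OF g_closed]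
    g_Om g_Ph g_PhS fa_in_carrier
  note evalA = A.fa_eval_add [of ?Y ?h, OF h_closed] A.fa_eval_mult [of ?Y ?h, OF h_closed]
    A.fa_eval_smult [of ?Y ?h, OF h_closed] A.fa_eval_gen [of ?Y ?h, OF h_closed]
    h_V h_VS fa_in_carrier

  \<comment> \<open>The last \<omega> relation recovers \<omega> from the other two generators; the
    round trip on \<open>Om a\<close> needs exactly this.\<close>
  have om_eq: "ph a \<otimes>\<^bsub>presented_alg ?X ?R\<^esub> ph' a \<oplus>\<^bsub>presented_alg ?X ?R\<^esub>
      pa_scal ?X ?R (inverse q) \<otimes>\<^bsub>presented_alg ?X ?R\<^esub> (ph' a \<otimes>\<^bsub>presented_alg ?X ?R\<^esub> ph a) = om a"
    if a: "a \<in> {1..n}" for a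
  proof -
    have "fa_gen (Ph a) ** fa_gen (PhS a) ++ fa_smult (inverse q) (fa_gen (PhS a) ** fa_gen (Ph a))
         ++ fa_smult (-1) (fa_gen (Om a)) \<in> ?R"
      using a unfolding clq_rels_def by blast
    from relA [OF this] show ?thesis
      using a by - (rule A.add_uminus_eq_zeroD, simp_all add: classA A.\<kappa>_uminus_mult)
  qed

  show ?thesis
  proof (rule alg_isomorphicI [where g = "cl_of_q q" and h = q_of_cl, OF RX SY g_carr h_carr])
    show "B.fa_eval ?g (q_of_cl y) = pa_class ?Y ?S (fa_gen y)" if "y \<in> ?Y" for y
      using that
      by (elim cgensE) (simp_all add: q_of_cl_def v_def v'_def evalB del: o_apply)
    show "A.fa_eval ?h (cl_of_q q x) = pa_class ?X ?R (fa_gen x)" if "x \<in> ?X" for x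
      using that
      by (elim qgensE) (simp_all add: cl_of_q_def evalA om_eq del: o_apply,
          simp_all add: om_def ph_def ph'_def)
    show "A.fa_eval ?h s = \<zero>\<^bsub>presented_alg ?X ?R\<^esub>" if s: "s \<in> ?S" for s
    proof -
      obtain a b where ab: "a \<in> {1..n}" "b \<in> {1..n}"
        and cases: "s = fa_gen (V a) ** fa_gen (V b) ++ fa_gen (V b) ** fa_gen (V a) \<or>
          s = fa_gen (VS a) ** fa_gen (VS b) ++ fa_gen (VS b) ** fa_gen (VS a) \<or>
          s = fa_gen (V a) ** fa_gen (VS b) ++ fa_gen (VS b) ** fa_gen (V a)
            ++ fa_scal (- of_nat (delta a b))"
        using s unfolding cl_rels_def by blast
      \<comment> \<open>Each classical relator is carried to a quantum one. For the mixed relator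
        this is the one with scalar -1 if the indices agree, and the one for distinct indices
        otherwise.\<close>
      have "fa_gen (Ph a) ** fa_gen (Ph b) ++ fa_gen (Ph b) ** fa_gen (Ph a) \<in> ?R"
        "fa_gen (PhS a) ** fa_gen (PhS b) ++ fa_gen (PhS b) ** fa_gen (PhS a) \<in> ?R"
        "fa_gen (Ph a) ** fa_gen (PhS a) ++ fa_gen (PhS a) ** fa_gen (Ph a) ++ fa_scal (-1) \<in> ?R"
        using ab unfolding clq_rels_def by blast+
      moreover have "fa_gen (Ph a) ** fa_gen (PhS b) ++ fa_gen (PhS b) ** fa_gen (Ph a) \<in> ?R"
        if "a \<noteq> b"
        using ab that unfolding clq_rels_def by (intro UN_I [of a] UN_I [of b]) auto
      ultimately show ?thesis
        using cases ab relA
        by (cases "a = b") (elim disjE; force simp: evalA classA delta_def simp del: o_apply)+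
    qed
    show "B.fa_eval ?g r = \<zero>\<^bsub>presented_alg ?Y ?S\<^esub>" if r: "r \<in> ?R" for r
    proof -
      obtain a b where ab: "a \<in> {1..n}" "b \<in> {1..n}"
        and "r \<in> { fa_gen (Om a) ** fa_gen (Om b) ++ fa_smult (-1) (fa_gen (Om b) ** fa_gen (Om a)),
          fa_gen (Om a) ** fa_gen (Om a) ++ fa_smult (-(1 + inverse q)) (fa_gen (Om a))
            ++ fa_scal (inverse q),
          fa_gen (Om a) ** fa_gen (Ph b)
            ++ fa_smult (- (q ^ delta a b)) (fa_gen (Ph b) ** fa_gen (Om a)),
          fa_gen (Om a) ** fa_gen (PhS b)
            ++ fa_smult (- (inverse q ^ delta a b)) (fa_gen (PhS b) ** fa_gen (Om a)),
          fa_gen (Ph a) ** fa_gen (Ph b) ++ fa_gen (Ph b) ** fa_gen (Ph a),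
          fa_gen (PhS a) ** fa_gen (PhS b) ++ fa_gen (PhS b) ** fa_gen (PhS a),
          fa_gen (Ph a) ** fa_gen (PhS a) ++ fa_gen (PhS a) ** fa_gen (Ph a) ++ fa_scal (-1),
          fa_gen (Ph a) ** fa_gen (PhS a)
            ++ fa_smult (inverse q) (fa_gen (PhS a) ** fa_gen (Ph a))
            ++ fa_smult (-1) (fa_gen (Om a))}
        \<union> (if a \<noteq> b then {fa_gen (Ph a) ** fa_gen (PhS b) ++ fa_gen (PhS b) ** fa_gen (Ph a)} else {})"
        using r unfolding clq_rels_def by blast
      then show ?thesis
        unfolding Un_iff insert_iff empty_iff
      proof (elim disjE FalseE)
        assume "r = fa_gen (Om a) ** fa_gen (Om b) ++ fa_smult (-1) (fa_gen (Om b) ** fa_gen (Om a))"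
        then show ?thesis
          using ab B.twist_twist [OF ab]
          by (simp add: evalB B.\<kappa>_uminus_mult B.r_neg del: o_apply)
      next
        assume "r = fa_gen (Om a) ** fa_gen (Om a) ++ fa_smult (-(1 + inverse q)) (fa_gen (Om a))
            ++ fa_scal (inverse q)"
        then show ?thesis
          using ab B.twist_v_square [of a "inverse q"] by (simp add: evalB del: o_apply)
      next
        \<comment> \<open>The exponent given by \<open>delta\<close> makes the factor
          \<open>q\<close> for equal indices and 1 for distinct ones, matching
          \<open>twist_v_same\<close> and \<open>twist_v\<close>.\<close>
        assume "r = fa_gen (Om a) ** fa_gen (Ph b)
            ++ fa_smult (- (q ^ delta a b)) (fa_gen (Ph b) ** fa_gen (Om a))"
        then show ?thesis
          using ab assms(2) B.twist_v_same [of q a] B.twist_v [OF ab]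
          by (cases "a = b")
            (simp_all add: evalB delta_def B.\<kappa>_uminus_mult B.r_neg del: o_apply)
      next
        assume "r = fa_gen (Om a) ** fa_gen (PhS b)
            ++ fa_smult (- (inverse q ^ delta a b)) (fa_gen (PhS b) ** fa_gen (Om a))"
        then show ?thesis
          using ab B.twist_v'_same [of a "inverse q"] B.twist_v' [OF ab]
          by (cases "a = b")
            (simp_all add: evalB delta_def B.\<kappa>_uminus_mult B.r_neg del: o_apply)
      next
        assume "r = fa_gen (Ph a) ** fa_gen (PhS a) ++ fa_gen (PhS a) ** fa_gen (Ph a)
            ++ fa_scal (-1)"
        then show ?thesis
          using ab by (simp add: evalB B.v_v'_same B.\<kappa>_uminus B.r_neg del: o_apply)
      next
        \<comment> \<open>Folding \<open>twist_def\<close> shows that this relator evaluates to the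
          twist minus itself.\<close>
        assume "r = fa_gen (Ph a) ** fa_gen (PhS a)
            ++ fa_smult (inverse q) (fa_gen (PhS a) ** fa_gen (Ph a))
            ++ fa_smult (-1) (fa_gen (Om a))"
        then show ?thesis
          using ab
          by (simp add: evalB B.\<kappa>_uminus_mult B.r_neg flip: B.twist_def del: o_apply)
      next
        assume "r \<in> (if a \<noteq> b
          then {fa_gen (Ph a) ** fa_gen (PhS b) ++ fa_gen (PhS b) ** fa_gen (Ph a)} else {})"
        then show ?thesis
          using ab by (cases "a = b") (simp_all add: evalB B.v_v' del: o_apply)
      qed (use ab in \<open>simp_all add: evalB B.v_v B.v'_v' del: o_apply\<close>)
    qed
  qed
qed

end
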